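(* Let $\mathcal{G}_A$ be a space of polytopes, i.e. suppose that all elements of $\mathcal{G}_A$ are bounded. Then for every $C\in\mathcal{K}_c(\mathbb{R}^d)$ we have $C\subset P_{\mathcal{G}_A}(C)$ and $$\mathrm{dist}(P_{\mathcal{G}_A}(C),C)\le\kappa_A\|C\|_2.$$
   Context: Let $A\in\mathbb{R}^{N\times d}$ be a fixed matrix whose rows $a_1^T,\ldots,a_N^T$ are pairwise distinct and satisfy $\|a_i\|_2=1$ for $i=1,\ldots,N$. For $b\in\mathbb{R}^N$ and $c\in\mathbb{R}^d$ put $Q_{A,b}:=\{x\in\mathbb{R}^d:Ax\le b\}$ and $Q_{A,c}^*:=\{p\in\mathbb{R}^N:p\ge0,\ A^Tp=c\}$; for $p\in\mathbb{R}^N$ with $p\ge 0$ put $I_p^*:=\{i:p_i>0\}$. Set $\mathcal{G}_A:=\{Q_{A,b}:b\in\mathbb{R}^N\}\setminus\{\emptyset\}$. $\mathcal{K}_c(\mathbb{R}^d)$ is the space of all nonempty convex compact subsets of $\mathbb{R}^d$. For $C,\tilde C\in\mathcal{K}_c(\mathbb{R}^d)$ put $\mathrm{dist}(C,\tilde C):=\sup_{c\in C}\inf_{\tilde c\in\tilde C}\|c-\tilde c\|_2$, $\|C\|_2:=\sup_{c\in C}\|c\|_2$ and $\sigma_C(x):=\sup_{c\in C}x^Tc$ for $x\in\mathbb{R}^d$. Define $P_{\mathcal{G}_A}(C):=Q_{A,b}$ with $b=(\sigma_C(a_1),\ldots,\sigma_C(a_N))^T$. With $S^{d-1}:=\{x\in\mathbb{R}^d:\|x\|_2=1\}$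 put $$\kappa_A:=\sup_{c\in S^{d-1}}\ \inf\Big\{\sum_{k\in I_p^*}p_k\Big\|a_k-\frac{c}{\|p\|_1}\Big\|_2:\ p\in Q_{A,c}^*\Big\}.$$ *)

theory Defs
  imports "HOL-Analysis.Analysis"
begin

definition polytope_Q :: "real^'d^'N \<Rightarrow> real^'N \<Rightarrow> (real^'d) set"
  where "polytope_Q A b = {x. A *v x \<le> b}"

definition dual_Q :: "real^'d^'N \<Rightarrow> real^'d \<Rightarrow> (real^'N) set"
  where "dual_Q A c = {p. 0 \<le> p \<and> transpose A *v p = c}"

definition pos_support :: "real^'N \<Rightarrow> 'N set"
  where "pos_support p = {i. p $ i > 0}"

definition norm1 :: "real^'N \<Rightarrow> real"
  where "norm1 p = (\<Sum>i\<in>UNIV. \<bar>p $ i\<bar>)"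

definition polytope_space :: "real^'d^'N \<Rightarrow> (real^'d) set set"
  where "polytope_space A = range (polytope_Q A) - {{}}"

text \<open>The one-sided (Hausdorff semi-)distance of \<open>C\<close> from \<open>D\<close>; \<open>infdist x D\<close> is
  the infimum of the Euclidean distances from \<open>x\<close> to the points of \<open>D\<close> (for \<open>D\<close> nonempty).\<close>

definition semidist :: "(real^'d) set \<Rightarrow> (real^'d) set \<Rightarrow> real"
  where "semidist C D = (SUP x\<in>C. infdist x D)"

definition set_norm :: "(real^'d) set \<Rightarrow> real"
  where "set_norm C = (SUP x\<in>C. norm x)"

definition support_fun :: "(real^'d) set \<Rightarrow> real^'d \<Rightarrow> real"
  where "support_fun C x = (SUP c\<in>C. x \<bullet> c)"

definition convex_bodies :: "(real^'d) set set"
  where "convex_bodies = {C. C \<noteq> {} \<and> convex C \<and> compact C}"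

definition proj_polytope :: "real^'d^'N \<Rightarrow> (real^'d) set \<Rightarrow> (real^'d) set"
  where "proj_polytope A C = polytope_Q A (\<chi> i. support_fun C (row i A))"

text \<open>The supremum and infimum are taken in the reals. If the members of \<open>polytope_space A\<close> are
  bounded and the rows of \<open>A\<close> are unit vectors, then \<open>{x. A *v x \<le> 0} = {0}\<close>, so by Farkas' lemma
  every \<open>dual_Q A c\<close> is nonempty; writing \<open>c\<close> in terms of the vectors \<open>\<plusminus> axis j 1\<close> yields elements
  of bounded 1-norm uniformly in \<open>c \<in> sphere 0 1\<close>, so the supremum is that of a
  nonempty bounded set.\<close>

definition kappa :: "real^'d^'N \<Rightarrow> real"
  where "kappa A = (SUP c\<in>sphere 0 1. INF p\<in>dual_Q A c.
    (\<Sum>k\<in>pos_support p. p $ k * norm (row k A - c /\<^sub>R norm1 p)))"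

end

theory Submission
  imports Defs
begin

text \<open>
  Let \<open>x\<close> be a point of the projected polytope outside \<open>C\<close>, let \<open>y\<close> be its nearest point in
  \<open>C\<close>, and let \<open>c\<close> be the unit vector pointing from \<open>y\<close> to \<open>x\<close>. Then \<open>c\<close> attains its maximum
  over \<open>C\<close> at \<open>y\<close>, and the distance is \<open>c \<bullet> x - c \<bullet> y\<close>. Weak linear programming duality bounds
  the first term: every \<open>p \<in> dual_Q A c\<close> writes \<open>c\<close> as \<open>\<Sum>k. p\<^sub>k a\<^sub>k\<close> with nonnegative weights,
  so \<open>c \<bullet> x \<le> \<Sum>k. p\<^sub>k \<sigma>\<^sub>C(a\<^sub>k)\<close>. Distributing the second term over the same
  weights, that is \<open>c \<bullet> y = \<Sum>k. p\<^sub>k (c / \<parallel>p\<parallel>\<^sub>1) \<bullet> y\<close>, the distance becomes a weighted sum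
  of differences of support values in the directions \<open>a\<^sub>k\<close> and \<open>c / \<parallel>p\<parallel>\<^sub>1\<close>. A support function
  is Lipschitz with constant \<open>set_norm C\<close>, which gives \<open>infdist_le_dual_cost\<close>: the distance is at
  most \<open>set_norm C\<close> times the cost of \<open>p\<close> whose infimum over \<open>p\<close> enters \<open>kappa\<close>.

  Passing to the infimum over \<open>p\<close> and the supremum over \<open>c\<close> requires that both be genuine:
  the dual polyhedra must be nonempty and the optimal costs bounded on the sphere. Nonemptiness
  (\<open>dual_Q_nonempty\<close>) holds because otherwise a hyperplane separating \<open>c\<close> from the cone
  spanned by the rows would give an unbounded ray in the polytope with right-hand side \<open>0\<close>. The
  bound (\<open>dual_Q_bounded_selection\<close>) comes from combining finitely many dual points, one for
  each signed coordinate direction.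
\<close>

section \<open>Dual multipliers and their cost\<close>

definition dual_cost :: "real^'d^'N \<Rightarrow> real^'d \<Rightarrow> real^'N \<Rightarrow> real"
  where "dual_cost A c p = (\<Sum>k\<in>pos_support p. p $ k * norm (row k A - c /\<^sub>R norm1 p))"

lemma kappa_eq: "kappa A = (SUP c\<in>sphere 0 1. INF p\<in>dual_Q A c. dual_cost A c p)"
  by (simp add: kappa_def dual_cost_def)

lemma dual_Q_nonneg: "p \<in> dual_Q A c \<Longrightarrow> 0 \<le> p $ k"
  by (simp add: dual_Q_def less_eq_vec_def)

lemma norm1_nonneg: "0 \<le> norm1 p"
  by (simp add: norm1_def sum_nonneg)

lemma norm1_nonneg_vector: "0 \<le> p \<Longrightarrow> norm1 p = (\<Sum>k\<in>UNIV. p $ k)"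
  by (simp add: norm1_def less_eq_vec_def)

lemma dual_cost_UNIV:
  assumes "0 \<le> p"
  shows "dual_cost A c p = (\<Sum>k\<in>UNIV. p $ k * norm (row k A - c /\<^sub>R norm1 p))"
  unfolding dual_cost_def
  by (rule sum.mono_neutral_left)
     (use assms in \<open>auto simp: pos_support_def less_eq_vec_def not_less intro: antisym\<close>)

lemma dual_cost_nonneg: "0 \<le> dual_cost A c p"
  unfolding dual_cost_def by (intro sum_nonneg) (simp add: pos_support_def)

lemma bdd_below_dual_cost: "bdd_below (dual_cost A c ` S)"
  by (rule bdd_belowI2[where m = 0]) (rule dual_cost_nonneg)

lemma dual_cost_le:
  assumes "\<forall>i. norm (row i A) = 1" and "0 \<le> p" and "norm c = 1"
  shows "dual_cost A c p \<le> norm1 p + 1"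
proof -
  have "norm (row k A - c /\<^sub>R norm1 p) \<le> 1 + \<bar>inverse (norm1 p)\<bar>" for k
    using norm_triangle_ineq4[of "row k A" "c /\<^sub>R norm1 p"] assms by simp
  then have "dual_cost A c p \<le> (\<Sum>k\<in>UNIV. p $ k * (1 + \<bar>inverse (norm1 p)\<bar>))"
    unfolding dual_cost_UNIV[OF assms(2)]
    by (intro sum_mono mult_left_mono) (use assms(2) in \<open>auto simp: less_eq_vec_def\<close>)
  also have "\<dots> = norm1 p * (1 + \<bar>inverse (norm1 p)\<bar>)"
    by (simp add: norm1_nonneg_vector[OF assms(2)] sum_distrib_right)
  also have "\<dots> \<le> norm1 p + 1"
    using assms(2) by (cases "norm1 p = 0") (auto simp: norm1_nonneg distrib_left)
  finally show ?thesis .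
qed

lemma row_inner_eq: "row k A \<bullet> x = (A *v x) $ k"
  by (simp add: matrix_vector_mul_component row_def vec_nth_inverse)

lemma dual_Q_inner:
  assumes "p \<in> dual_Q A c"
  shows "c \<bullet> x = (\<Sum>k\<in>UNIV. p $ k * (row k A \<bullet> x))"
proof -
  have "c \<bullet> x = p \<bullet> (A *v x)"
    using assms by (auto simp: dual_Q_def transpose_matrix_vector dot_lmul_matrix)
  then show ?thesis by (simp only: inner_vec_def[of p] row_inner_eq inner_real_def)
qed

lemma dual_Q_norm1_pos:
  assumes "p \<in> dual_Q A c" and "c \<noteq> 0"
  shows "0 < norm1 p"
proof (rule ccontr)
  assume "\<not> 0 < norm1 p"
  then have "norm1 p = 0" using norm1_nonneg[of p] by simp
  then have "p = 0"
    by (simp add: norm1_def vec_eq_iff sum_nonneg_eq_0_iff)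
  then show False using assms by (simp add: dual_Q_def)
qed

section \<open>Existence and boundedness of dual multipliers\<close>

lemma dual_Q_add: "p \<in> dual_Q A c \<Longrightarrow> q \<in> dual_Q A d \<Longrightarrow> p + q \<in> dual_Q A (c + d)"
  by (auto simp: dual_Q_def matrix_vector_right_distrib less_eq_vec_def
      simp del: transpose_matrix_vector)

lemma dual_Q_scale: "p \<in> dual_Q A c \<Longrightarrow> 0 \<le> t \<Longrightarrow> t *\<^sub>R p \<in> dual_Q A (t *\<^sub>R c)"
  by (auto simp: dual_Q_def matrix_vector_mult_scaleR less_eq_vec_def
      simp del: transpose_matrix_vector)

lemma dual_Q_sum:
  assumes "\<And>j. j \<in> J \<Longrightarrow> p j \<in> dual_Q A (c j)"
  shows "(\<Sum>j\<in>J. p j) \<in> dual_Q A (\<Sum>j\<in>J. c j)"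
  using assms
proof (induction J rule: infinite_finite_induct)
  case (insert j J)
  then show ?case using dual_Q_add[of "p j" A "c j"] by simp
qed (simp_all add: dual_Q_def)

lemma dual_Q_axis: "axis k 1 \<in> dual_Q A (row k A)"
  by (simp add: dual_Q_def less_eq_vec_def axis_def matrix_vector_mult_def transpose_def row_def
      vec_eq_iff if_distrib cong: if_cong)

text \<open>The cone generated by the rows is the whole space: a vector \<open>c\<close> outside it would be weakly
  separated from it by some \<open>a \<noteq> 0\<close> making a nonnegative inner product with every row, and then
  all multiples \<open>-s a\<close> with \<open>s \<ge> 0\<close> solve \<open>A x \<le> 0\<close>. The set \<open>S\<close> below is the cone
  translated by \<open>-c\<close>, so that the separation takes place at the origin.\<close>

lemma dual_Q_nonempty:
  fixes A :: "real^'d^'N"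
  assumes "bounded (polytope_Q A 0)"
  shows "dual_Q A c \<noteq> {}"
proof
  assume empty: "dual_Q A c = {}"
  define S where "S = {v. dual_Q A (v + c) \<noteq> {}}"
  have "convex S"
    unfolding convex_def
  proof (intro ballI allI impI)
    fix v w and s t :: real
    assume *: "v \<in> S" "w \<in> S" "0 \<le> s" "0 \<le> t" "s + t = 1"
    then obtain p q where "p \<in> dual_Q A (v + c)" "q \<in> dual_Q A (w + c)"
      by (auto simp: S_def)
    then have "s *\<^sub>R p + t *\<^sub>R q \<in> dual_Q A (s *\<^sub>R (v + c) + t *\<^sub>R (w + c))"
      using * by (intro dual_Q_add dual_Q_scale)
    also have "s *\<^sub>R (v + c) + t *\<^sub>R (w + c) = (s *\<^sub>R v + t *\<^sub>R w) + (s + t) *\<^sub>R c"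
      by (simp add: algebra_simps)
    finally show "s *\<^sub>R v + t *\<^sub>R w \<in> S"
      using * by (auto simp: S_def)
  qed
  moreover have "0 \<notin> S" using empty by (simp add: S_def)
  ultimately obtain a where a: "a \<noteq> 0" "\<And>v. v \<in> S \<Longrightarrow> 0 \<le> a \<bullet> v"
    using separating_hyperplane_set_0[of S] by blast
  \<comment> \<open>The cone contains the whole ray through row \<open>k\<close>. Were its inner product with \<open>a\<close> negative,
      the point at parameter \<open>t\<close>, where it equals \<open>-(\<bar>a \<bullet> c\<bar> + 1)\<close>, would lie on the wrong side.\<close>
  have row_nonneg: "0 \<le> a \<bullet> row k A" for k
  proof (rule ccontr)
    assume neg: "\<not> 0 \<le> a \<bullet> row k A"
    define t where "t = (\<bar>a \<bullet> c\<bar> + 1) / (- (a \<bullet> row k A))"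
    have "0 \<le> t" using neg by (simp add: t_def field_simps)
    then have "t *\<^sub>R row k A - c \<in> S"
      using dual_Q_scale[OF dual_Q_axis] by (fastforce simp: S_def)
    then have "0 \<le> t * (a \<bullet> row k A) - a \<bullet> c"
      using a(2) by (fastforce simp: inner_diff_right)
    moreover have "t * (a \<bullet> row k A) = - (\<bar>a \<bullet> c\<bar> + 1)"
      using neg by (simp add: t_def field_simps)
    ultimately show False by linarith
  qed
  obtain B where B: "\<And>x. x \<in> polytope_Q A 0 \<Longrightarrow> norm x \<le> B"
    using assms by (auto simp: bounded_iff)
  define s where "s = (\<bar>B\<bar> + 1) / norm a"
  have "s \<ge> 0" by (simp add: s_def)
  then have "(- s) *\<^sub>R a \<in> polytope_Q A 0"
    using row_nonneg
    by (auto simp: polytope_Q_def less_eq_vec_def row_inner_eq[symmetric] inner_commute)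
  then have "norm ((- s) *\<^sub>R a) \<le> B" by (rule B)
  moreover have "norm ((- s) *\<^sub>R a) = \<bar>B\<bar> + 1"
    using a(1) by (simp add: s_def)
  ultimately show False by linarith
qed

lemma norm1_add_le: "norm1 (p + q) \<le> norm1 p + norm1 q"
  by (simp add: norm1_def sum.distrib[symmetric] sum_mono abs_triangle_ineq)

lemma norm1_scale: "norm1 (t *\<^sub>R p) = \<bar>t\<bar> * norm1 p"
  by (simp add: norm1_def abs_mult sum_distrib_left)

lemma norm1_sum_le: "norm1 (\<Sum>j\<in>J. p j) \<le> (\<Sum>j\<in>J. norm1 (p j))"
proof (induction J rule: infinite_finite_induct)
  case (insert j J)
  then show ?case using norm1_add_le[of "p j" "sum p J"] by simp
qed (simp_all add: norm1_def)

text \<open>The positive and negative parts of the coordinates of \<open>c\<close>, each at most \<open>1\<close>, serve as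
  coefficients of fixed dual points for \<open>e\<^sub>j\<close> and \<open>-e\<^sub>j\<close>.\<close>

lemma dual_Q_bounded_selection:
  fixes A :: "real^'d^'N"
  assumes "\<And>c. dual_Q A c \<noteq> {}"
  obtains M where "\<And>c. norm c = 1 \<Longrightarrow> \<exists>p\<in>dual_Q A c. norm1 p \<le> M"
proof -
  have "\<forall>c. \<exists>p. p \<in> dual_Q A c" using assms by blast
  then obtain g where g: "\<And>c. g c \<in> dual_Q A c" by metis
  define M where "M = (\<Sum>j\<in>UNIV. norm1 (g (axis j 1)) + norm1 (g (- axis j 1)))"
  have "\<exists>p\<in>dual_Q A c. norm1 p \<le> M" if "norm c = 1" for c
  proof -
    define q where "q j = max 0 (c $ j) *\<^sub>R g (axis j 1) + max 0 (- c $ j) *\<^sub>R g (- axis j 1)" for j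
    have "q j \<in> dual_Q A (max 0 (c $ j) *\<^sub>R axis j 1 + max 0 (- c $ j) *\<^sub>R (- axis j 1))" for j
      unfolding q_def by (intro dual_Q_add dual_Q_scale g) auto
    also have "max 0 (c $ j) *\<^sub>R axis j 1 + max 0 (- c $ j) *\<^sub>R (- axis j 1) = (c $ j) *\<^sub>R axis j (1::real)"
      for j by (simp add: max_def)
    finally have "(\<Sum>j\<in>UNIV. q j) \<in> dual_Q A (\<Sum>j\<in>UNIV. (c $ j) *\<^sub>R axis j 1)"
      by (rule dual_Q_sum)
    also have "(\<Sum>j\<in>UNIV. (c $ j) *\<^sub>R axis j 1) = c"
      using basis_expansion[of c] by (simp add: scalar_mult_eq_scaleR)
    finally have mem: "(\<Sum>j\<in>UNIV. q j) \<in> dual_Q A c" .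
    have "norm1 (q j) \<le> norm1 (g (axis j 1)) + norm1 (g (- axis j 1))" for j
    proof -
      have "\<bar>c $ j\<bar> \<le> 1" using component_le_norm_cart[of c j] that by simp
      then have "\<bar>max 0 (c $ j)\<bar> \<le> 1" and "\<bar>max 0 (- c $ j)\<bar> \<le> 1" by auto
      then show ?thesis
        unfolding q_def
        by (intro order_trans[OF norm1_add_le] add_mono)
           (simp_all only: norm1_scale mult_left_le_one_le norm1_nonneg abs_ge_zero)
    qed
    then have "norm1 (\<Sum>j\<in>UNIV. q j) \<le> M"
      unfolding M_def by (intro order_trans[OF norm1_sum_le] sum_mono)
    then show ?thesis using mem by blast
  qed
  then show thesis by (rule that)
qed

lemma INF_dual_cost_le_kappa:
  fixes A :: "real^'d^'N"
  assumes unit: "\<forall>i. norm (row i A) = 1" and nonempty: "\<And>c. dual_Q A c \<noteq> {}" and "norm c = 1"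
  shows "(INF p\<in>dual_Q A c. dual_cost A c p) \<le> kappa A"
proof -
  obtain M where M: "\<And>c. norm c = 1 \<Longrightarrow> \<exists>p\<in>dual_Q A c. norm1 p \<le> M"
    by (rule dual_Q_bounded_selection[OF nonempty]) blast
  have "(INF p\<in>dual_Q A v. dual_cost A v p) \<le> M + 1" if v: "norm v = 1" for v
  proof -
    obtain p where p: "p \<in> dual_Q A v" "norm1 p \<le> M" using M[OF v] by blast
    have "(INF p\<in>dual_Q A v. dual_cost A v p) \<le> dual_cost A v p"
      using bdd_below_dual_cost p(1) by (rule cINF_lower)
    also have "\<dots> \<le> norm1 p + 1"
      using unit p(1) v by (intro dual_cost_le) (auto simp: dual_Q_def)
    finally show ?thesis using p(2) by simp
  qed
  then have "bdd_above ((\<lambda>v. INF p\<in>dual_Q A v. dual_cost A v p) ` sphere 0 1)"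
    by (intro bdd_aboveI2[where M = "M + 1"]) simp
  then show ?thesis
    unfolding kappa_eq using assms(3) by (intro cSUP_upper) simp_all
qed

lemma kappa_nonneg:
  fixes A :: "real^'d^'N"
  assumes "\<forall>i. norm (row i A) = 1" and "\<And>c. dual_Q A c \<noteq> {}"
  shows "0 \<le> kappa A"
proof -
  obtain c :: "real^'d" where c: "norm c = 1" using vector_choose_size[of 1] by auto
  have "0 \<le> (INF p\<in>dual_Q A c. dual_cost A c p)"
    using assms(2) by (intro cINF_greatest dual_cost_nonneg)
  also have "\<dots> \<le> kappa A" using assms c by (rule INF_dual_cost_le_kappa)
  finally show ?thesis .
qed

section \<open>Support values and the distance estimate\<close>

lemma norm_le_set_norm:
  assumes "compact C" and "z \<in> C"
  shows "norm z \<le> set_norm C"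
proof -
  have "bdd_above (norm ` C)"
    using compact_imp_bounded[OF assms(1)] by (simp add: bdd_above_norm)
  then show ?thesis unfolding set_norm_def using assms(2) by (intro cSUP_upper)
qed

lemma inner_le_support_fun:
  assumes "compact C" and "z \<in> C"
  shows "v \<bullet> z \<le> support_fun C v"
proof -
  have "compact ((\<lambda>z. v \<bullet> z) ` C)"
    using assms(1) by (intro compact_continuous_image continuous_intros)
  then have "bdd_above ((\<lambda>z. v \<bullet> z) ` C)"
    by (intro bounded_imp_bdd_above compact_imp_bounded)
  then show ?thesis unfolding support_fun_def using assms(2) by (intro cSUP_upper)
qed

lemma subset_proj_polytope: "compact C \<Longrightarrow> C \<subseteq> proj_polytope A C"
  by (auto simp: proj_polytope_def polytope_Q_def less_eq_vec_def row_inner_eq[symmetric]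
      intro: inner_le_support_fun)

text \<open>The Lipschitz estimate for the support function, stated for a direction \<open>u\<close> whose support
  value is attained at a known point.\<close>

lemma support_fun_le_at_maximizer:
  assumes "compact C" and "y \<in> C" and max: "\<And>z. z \<in> C \<Longrightarrow> u \<bullet> z \<le> u \<bullet> y"
  shows "support_fun C v \<le> u \<bullet> y + norm (v - u) * set_norm C"
  unfolding support_fun_def
proof (rule cSUP_least)
  show "C \<noteq> {}" using assms(2) by blast
  fix z assume z: "z \<in> C"
  have "v \<bullet> z = u \<bullet> z + (v - u) \<bullet> z" by (simp add: inner_diff_left)
  also have "\<dots> \<le> u \<bullet> y + norm (v - u) * norm z"
    by (intro add_mono max z norm_cauchy_schwarz)
  also have "\<dots> \<le> u \<bullet> y + norm (v - u) * set_norm C"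
    using norm_le_set_norm[OF assms(1) z] by (simp add: mult_left_mono)
  finally show "v \<bullet> z \<le> u \<bullet> y + norm (v - u) * set_norm C" .
qed

text \<open>Weak duality turns \<open>c \<bullet> x\<close> into support values in the row directions; normalising by
  \<open>\<parallel>p\<parallel>\<^sub>1\<close> lets \<open>c \<bullet> y\<close> be spread over the same weights, so that the two can be compared term by
  term.\<close>

lemma inner_diff_le_dual_cost:
  fixes A :: "real^'d^'N"
  assumes "compact C" and x: "x \<in> proj_polytope A C" and y: "y \<in> C"
    and max: "\<And>z. z \<in> C \<Longrightarrow> c \<bullet> z \<le> c \<bullet> y"
    and p: "p \<in> dual_Q A c" and "c \<noteq> 0"
  shows "c \<bullet> x - c \<bullet> y \<le> dual_cost A c p * set_norm C"
proof -
  define u where "u = c /\<^sub>R norm1 p"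
  have p0: "0 \<le> p" using p by (simp add: dual_Q_def)
  have n: "0 < norm1 p" using p assms(6) by (rule dual_Q_norm1_pos)
  have umax: "u \<bullet> z \<le> u \<bullet> y" if "z \<in> C" for z
    using max[OF that] n by (simp add: u_def mult_left_mono)
  have row: "row k A \<bullet> x \<le> u \<bullet> y + norm (row k A - u) * set_norm C" for k
  proof -
    have "row k A \<bullet> x \<le> support_fun C (row k A)"
      using x by (simp add: proj_polytope_def polytope_Q_def less_eq_vec_def row_inner_eq)
    also have "\<dots> \<le> u \<bullet> y + norm (row k A - u) * set_norm C"
      using assms(1) y umax by (rule support_fun_le_at_maximizer)
    finally show ?thesis .
  qed
  have "c \<bullet> x = (\<Sum>k\<in>UNIV. p $ k * (row k A \<bullet> x))"
    using p by (rule dual_Q_inner)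
  also have "\<dots> \<le> (\<Sum>k\<in>UNIV. p $ k * (u \<bullet> y + norm (row k A - u) * set_norm C))"
    by (intro sum_mono mult_left_mono row dual_Q_nonneg[OF p])
  also have "\<dots> = norm1 p * (u \<bullet> y) + dual_cost A c p * set_norm C"
    by (simp add: dual_cost_UNIV[OF p0] norm1_nonneg_vector[OF p0] u_def distrib_left sum.distrib
        sum_distrib_right mult.assoc)
  also have "norm1 p * (u \<bullet> y) = c \<bullet> y"
    using n by (simp add: u_def)
  finally show ?thesis by simp
qed

text \<open>The nearest point \<open>y\<close> to \<open>x\<close> is characterised by the variational inequality which says that
  the direction from \<open>y\<close> to \<open>x\<close> is maximised over \<open>C\<close> at \<open>y\<close>.\<close>

lemma infdist_le_dual_cost:
  fixes A :: "real^'d^'N"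
  assumes "C \<in> convex_bodies" and x: "x \<in> proj_polytope A C" and "x \<notin> C"
  obtains c where "norm c = 1"
    and "\<And>p. p \<in> dual_Q A c \<Longrightarrow> infdist x C \<le> dual_cost A c p * set_norm C"
proof -
  have C: "C \<noteq> {}" "convex C" "compact C" "closed C"
    using assms(1) by (auto simp: convex_bodies_def compact_imp_closed)
  define y where "y = closest_point C x"
  have y: "y \<in> C" unfolding y_def using C by (intro closest_point_in_set)
  then have xy: "x \<noteq> y" using assms(3) by blast
  define c where "c = (x - y) /\<^sub>R norm (x - y)"
  have "norm c = 1" using xy by (simp add: c_def)
  moreover have "infdist x C \<le> dual_cost A c p * set_norm C" if p: "p \<in> dual_Q A c" for p
  proof -
    have max: "c \<bullet> z \<le> c \<bullet> y" if "z \<in> C" for z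
    proof -
      have "(x - y) \<bullet> (z - y) \<le> 0"
        unfolding y_def using C that by (intro closest_point_dot)
      then have "(x - y) \<bullet> z \<le> (x - y) \<bullet> y" by (simp add: inner_diff_right)
      then show ?thesis by (simp add: c_def mult_left_mono)
    qed
    have "infdist x C \<le> dist x y" using y by (rule infdist_le)
    also have "\<dots> = c \<bullet> (x - y)"
      using xy by (simp add: c_def dist_norm dot_square_norm power2_eq_square)
    also have "\<dots> = c \<bullet> x - c \<bullet> y" by (rule inner_diff_right)
    also have "\<dots> \<le> dual_cost A c p * set_norm C"
      using C(3) x y max p by (rule inner_diff_le_dual_cost) (use \<open>norm c = 1\<close> in auto)
    finally show ?thesis .
  qed
  ultimately show thesis by (rule that)
qed

theorem theorem40:
  fixes A :: "real^'d^'N"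
  assumes "inj (\<lambda>i. row i A)"
    and "\<forall>i. norm (row i A) = 1"
    and "\<forall>Q\<in>polytope_space A. bounded Q"
  shows "\<forall>C\<in>convex_bodies. C \<subseteq> proj_polytope A C \<and>
    semidist (proj_polytope A C) C \<le> kappa A * set_norm C"
proof
  fix C :: "(real^'d) set"
  assume body: "C \<in> convex_bodies"
  then have C: "C \<noteq> {}" "compact C" by (auto simp: convex_bodies_def)
  then have sub: "C \<subseteq> proj_polytope A C" by (simp add: subset_proj_polytope)
  have "0 \<in> polytope_Q A 0" by (simp add: polytope_Q_def)
  then have "bounded (polytope_Q A 0)"
    using assms(3) by (auto simp: polytope_space_def)
  then have nonempty: "dual_Q A c \<noteq> {}" for c by (rule dual_Q_nonempty)
  have R: "0 \<le> set_norm C"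
    using C norm_le_set_norm norm_ge_zero order_trans by (metis ex_in_conv)
  have "infdist x C \<le> kappa A * set_norm C" if x: "x \<in> proj_polytope A C" for x
  proof (cases "infdist x C = 0")
    case True
    then show ?thesis using kappa_nonneg[OF assms(2) nonempty] R by simp
  next
    case False
    then have pos: "0 < infdist x C" using infdist_nonneg[of x C] by linarith
    then have "x \<notin> C" by auto
    with body x obtain c where c: "norm c = 1"
      and le: "\<And>p. p \<in> dual_Q A c \<Longrightarrow> infdist x C \<le> dual_cost A c p * set_norm C"
      by (rule infdist_le_dual_cost) blast
    \<comment> \<open>A positive distance forces \<open>C \<noteq> {0}\<close>, so the factor \<open>set_norm C\<close> can be divided out
      before the infimum is taken.\<close>
    obtain p where "p \<in> dual_Q A c" using nonempty by blast
    then have "set_norm C \<noteq> 0" using le pos by fastforce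
    then have Rpos: "0 < set_norm C" using R by simp
    have "infdist x C / set_norm C \<le> (INF p\<in>dual_Q A c. dual_cost A c p)"
      using nonempty le Rpos by (intro cINF_greatest) (auto simp: pos_divide_le_eq)
    also have "\<dots> \<le> kappa A"
      using assms(2) nonempty c by (rule INF_dual_cost_le_kappa)
    finally show ?thesis using Rpos by (simp add: pos_divide_le_eq)
  qed
  then have "semidist (proj_polytope A C) C \<le> kappa A * set_norm C"
    unfolding semidist_def using C(1) sub by (intro cSUP_least) auto
  with sub show "C \<subseteq> proj_polytope A C \<and> semidist (proj_polytope A C) C \<le> kappa A * set_norm C"
    by blast
qed

end
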